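(* Let $R$ be a commutative ring with nonzero identity and $M$ an $R$-module. If $N$ is a weakly classical prime submodule of $M$ that is not a classical prime submodule, then $(N:_R M)^2N=0$, and so $N$ is a nilpotent submodule of $M$.
   Context: All rings are commutative with nonzero identity and all modules are unitary. A proper submodule $N$ of $M$ is classical prime if for all $a,b\in R$ and $m\in M$, $abm\in N$ implies $am\in N$ or $bm\in N$. A proper submodule $N$ of $M$ is weakly classical prime if for all $a,b\in R$ and $m\in M$, $0\neq abm\in N$ implies $am\in N$ or $bm\in N$. $(N:_R M)=\{r\in R\mid rM\subseteq N\}$. A submodule $N$ of $M$ is nilpotent if $(N:_R M)^kN=0$ for some positive integer $k$. *)

theory Defs
  imports "HOL-Algebra.Module" "HOL-Algebra.Ideal_Product"
begin

text \<open>
  The parameter \<open>R\<close> is the ring of scalars and \<open>M\<close> the module; \<open>residual R M N\<close> is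
  \<open>(N :\<^sub>R M)\<close>.
\<close>

definition residual ::
  "('r, 'k) ring_scheme \<Rightarrow> ('r, 'm, 'l) module_scheme \<Rightarrow> 'm set \<Rightarrow> 'r set"
  where "residual R M N = {r \<in> carrier R. (\<lambda>m. r \<odot>\<^bsub>M\<^esub> m) ` carrier M \<subseteq> N}"

definition submodule_generated ::
  "('r, 'k) ring_scheme \<Rightarrow> ('r, 'm, 'l) module_scheme \<Rightarrow> 'm set \<Rightarrow> 'm set"
  where "submodule_generated R M S = \<Inter>{K. submodule K R M \<and> S \<subseteq> K}"

text \<open>
  The product \<open>I N\<close> of an ideal and a submodule is the submodule generated by the elementwise
  products, not merely the set of those products.
\<close>

definition ideal_submodule_prod ::
  "('r, 'k) ring_scheme \<Rightarrow> ('r, 'm, 'l) module_scheme \<Rightarrow> 'r set \<Rightarrow> 'm set \<Rightarrow> 'm set"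
  where "ideal_submodule_prod R M I N =
    submodule_generated R M {a \<odot>\<^bsub>M\<^esub> x | a x. a \<in> I \<and> x \<in> N}"

definition classical_prime_submodule ::
  "('r, 'k) ring_scheme \<Rightarrow> ('r, 'm, 'l) module_scheme \<Rightarrow> 'm set \<Rightarrow> bool"
  where "classical_prime_submodule R M N \<longleftrightarrow>
    submodule N R M \<and> N \<noteq> carrier M \<and>
    (\<forall>a \<in> carrier R. \<forall>b \<in> carrier R. \<forall>m \<in> carrier M.
      (a \<otimes>\<^bsub>R\<^esub> b) \<odot>\<^bsub>M\<^esub> m \<in> N \<longrightarrow> a \<odot>\<^bsub>M\<^esub> m \<in> N \<or> b \<odot>\<^bsub>M\<^esub> m \<in> N)"

definition weakly_classical_prime_submodule ::
  "('r, 'k) ring_scheme \<Rightarrow> ('r, 'm, 'l) module_scheme \<Rightarrow> 'm set \<Rightarrow> bool"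
  where "weakly_classical_prime_submodule R M N \<longleftrightarrow>
    submodule N R M \<and> N \<noteq> carrier M \<and>
    (\<forall>a \<in> carrier R. \<forall>b \<in> carrier R. \<forall>m \<in> carrier M.
      (a \<otimes>\<^bsub>R\<^esub> b) \<odot>\<^bsub>M\<^esub> m \<noteq> \<zero>\<^bsub>M\<^esub> \<and> (a \<otimes>\<^bsub>R\<^esub> b) \<odot>\<^bsub>M\<^esub> m \<in> N \<longrightarrow>
      a \<odot>\<^bsub>M\<^esub> m \<in> N \<or> b \<odot>\<^bsub>M\<^esub> m \<in> N)"

text \<open>
  Powers of an ideal are taken in the multiplicative monoid of ideals, \<open>ideals_set R\<close>, whose
  multiplication is the ideal product (finite sums of products) and whose unit is \<open>carrier R\<close>.
\<close>

definition nilpotent_submodule ::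
  "('r, 'k) ring_scheme \<Rightarrow> ('r, 'm, 'l) module_scheme \<Rightarrow> 'm set \<Rightarrow> bool"
  where "nilpotent_submodule R M N \<longleftrightarrow>
    submodule N R M \<and>
    (\<exists>k::nat. k > 0 \<and>
      ideal_submodule_prod R M (residual R M N [^]\<^bsub>ideals_set R\<^esub> k) N = {\<zero>\<^bsub>M\<^esub>})"

end

theory Submission
  imports Defs
begin

text \<open>
  Choose \<open>a\<close>, \<open>b\<close>, \<open>m\<close> with \<open>a b m \<in> N\<close> but \<open>a m \<notin> N\<close> and \<open>b m \<notin> N\<close>. All these conditions
  survive replacing \<open>a\<close>, \<open>b\<close>, \<open>m\<close> by \<open>a + r\<close>, \<open>b + s\<close>, \<open>m + n\<close> with \<open>r, s \<in> (N : M)\<close> and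
  \<open>n \<in> N\<close>, so weak primeness gives \<open>(a + r) (b + s) (m + n) = 0\<close> for all such \<open>r\<close>, \<open>s\<close>, \<open>n\<close>.
  Subtracting in turn the instances \<open>n = 0\<close>, \<open>s = 0\<close> and \<open>r = 0\<close> leaves \<open>r s n = 0\<close>.
\<close>

context module
begin

lemma submodule_zero_closed:
  assumes "submodule N R M"
  shows "\<zero>\<^bsub>M\<^esub> \<in> N"
  using subgroup.one_closed[OF submodule.axioms(1)[OF assms]] by simp

text \<open>Used contrapositively: adding an element of \<open>N\<close> cannot move a vector from
  outside \<open>N\<close> into \<open>N\<close>.\<close>

lemma submodule_add_cancel:
  assumes N: "submodule N R M"
    and x: "x \<in> carrier M" and y: "y \<in> N" and xy: "x \<oplus>\<^bsub>M\<^esub> y \<in> N"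
  shows "x \<in> N"
proof -
  have yc: "y \<in> carrier M"
    using submoduleE(1)[OF N] y by blast
  have "(x \<oplus>\<^bsub>M\<^esub> y) \<oplus>\<^bsub>M\<^esub> (\<ominus>\<^bsub>M\<^esub> y) \<in> N"
    by (rule submoduleE(5)[OF N xy submoduleE(3)[OF N y]])
  then show ?thesis
    using x yc by (simp add: M.a_assoc M.r_neg)
qed

lemma zero_submodule: "submodule {\<zero>\<^bsub>M\<^esub>} R M"
  by (rule submoduleI) auto

lemma submodule_generated_eq_zero:
  assumes "S \<subseteq> {\<zero>\<^bsub>M\<^esub>}"
  shows "submodule_generated R M S = {\<zero>\<^bsub>M\<^esub>}"
  using assms zero_submodule submodule_zero_closed
  unfolding submodule_generated_def by blast

lemma residualD:
  assumes "r \<in> residual R M N"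
  shows "r \<in> carrier R" and "\<And>x. x \<in> carrier M \<Longrightarrow> r \<odot>\<^bsub>M\<^esub> x \<in> N"
  using assms by (auto simp: residual_def)

text \<open>Puts the residual into the carrier of the monoid \<open>ideals_set R\<close>, so that
  the monoid laws apply to its powers.\<close>

lemma ideal_residual:
  assumes N: "submodule N R M"
  shows "ideal (residual R M N) R"
proof (rule idealI)
  show "ring R" ..
  show "subgroup (residual R M N) (add_monoid R)"
  proof (rule R.add.subgroupI)
    show "residual R M N \<subseteq> carrier R"
      by (auto simp: residual_def)
    have "\<zero> \<in> residual R M N"
      using submodule_zero_closed[OF N] by (auto simp: residual_def)
    then show "residual R M N \<noteq> {}"
      by blast
  next
    fix a assume "a \<in> residual R M N"
    then show "\<ominus> a \<in> residual R M N"
      using submoduleE(3)[OF N] by (auto simp: residual_def smult_l_minus)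
  next
    fix a b assume "a \<in> residual R M N" "b \<in> residual R M N"
    then show "a \<oplus> b \<in> residual R M N"
      by (auto simp: residual_def smult_l_distr image_subset_iff intro: submoduleE(5)[OF N])
  qed
next
  fix a x assume a: "a \<in> residual R M N" and x: "x \<in> carrier R"
  show "x \<otimes> a \<in> residual R M N"
    using a x submoduleE(4)[OF N] by (auto simp: residual_def smult_assoc1)
  then show "a \<otimes> x \<in> residual R M N"
    using residualD(1)[OF a] x by (simp add: m_comm)
qed

text \<open>The power unfolds to unit times \<open>I\<close> times \<open>I\<close>; the unit law
  that removes the first factor holds for ideals.\<close>

lemma ideals_set_pow_2:
  assumes "ideal I R"
  shows "I [^]\<^bsub>ideals_set R\<^esub> (2::nat) = ideal_prod R I I"
proof -
  interpret I: comm_monoid "ideals_set R"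
    by (rule R.ideals_set_is_comm_monoid)
  have "I \<in> carrier (ideals_set R)"
    using assms by (simp add: ideals_set_def)
  then have "I [^]\<^bsub>ideals_set R\<^esub> (2::nat) = I \<otimes>\<^bsub>ideals_set R\<^esub> I"
    by (simp add: numeral_2_eq_2)
  then show ?thesis
    by (simp add: ideals_set_def)
qed

text \<open>Elements of the ideal product are finite sums of products, and the annihilator of
  \<open>x\<close> is closed under sums.\<close>

lemma ideal_prod_smult_eq_zero:
  assumes I: "I \<subseteq> carrier R" and J: "J \<subseteq> carrier R" and x: "x \<in> carrier M"
    and zero: "\<And>i j. \<lbrakk>i \<in> I; j \<in> J\<rbrakk> \<Longrightarrow> (i \<otimes> j) \<odot>\<^bsub>M\<^esub> x = \<zero>\<^bsub>M\<^esub>"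
    and c: "c \<in> ideal_prod R I J"
  shows "c \<odot>\<^bsub>M\<^esub> x = \<zero>\<^bsub>M\<^esub>"
proof -
  \<comment> \<open>Carrier membership joins the induction because distributivity needs it in the
    \<open>sum\<close> case.\<close>
  have "c \<in> carrier R \<and> c \<odot>\<^bsub>M\<^esub> x = \<zero>\<^bsub>M\<^esub>"
    using c
  proof (induction rule: ideal_prod.induct)
    case (prod i j)
    then show ?case
      using I J zero by blast
  next
    case (sum s t)
    then show ?case
      using x by (simp add: smult_l_distr)
  qed
  then show ?thesis ..
qed

lemma weakly_classical_prime_perturbation:
  assumes wcp: "weakly_classical_prime_submodule R M N"
    and a: "a \<in> carrier R" and b: "b \<in> carrier R" and m: "m \<in> carrier M"
    and abm: "(a \<otimes> b) \<odot>\<^bsub>M\<^esub> m \<in> N"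
    and am: "a \<odot>\<^bsub>M\<^esub> m \<notin> N" and bm: "b \<odot>\<^bsub>M\<^esub> m \<notin> N"
    and r: "r \<in> residual R M N" and s: "s \<in> residual R M N" and n: "n \<in> N"
  shows "((a \<oplus> r) \<otimes> (b \<oplus> s)) \<odot>\<^bsub>M\<^esub> (m \<oplus>\<^bsub>M\<^esub> n) = \<zero>\<^bsub>M\<^esub>"
proof (rule ccontr)
  assume nz: "((a \<oplus> r) \<otimes> (b \<oplus> s)) \<odot>\<^bsub>M\<^esub> (m \<oplus>\<^bsub>M\<^esub> n) \<noteq> \<zero>\<^bsub>M\<^esub>"
  have N: "submodule N R M"
    using wcp by (simp add: weakly_classical_prime_submodule_def)
  note add = submoduleE(5)[OF N] and smult = submoduleE(4)[OF N]
  have nc: "n \<in> carrier M"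
    using submoduleE(1)[OF N] n by blast
  note rc = residualD(1)[OF r] and sc = residualD(1)[OF s]
  \<comment> \<open>The perturbed vector differs from \<open>c m\<close> by
    \<open>c n + t (m + n)\<close>, which lies in \<open>N\<close>. Stated for generic
    \<open>c\<close> and \<open>t\<close> to serve both \<open>a + r\<close> and
    \<open>b + s\<close>.\<close>
  have notin: "(c \<oplus> t) \<odot>\<^bsub>M\<^esub> (m \<oplus>\<^bsub>M\<^esub> n) \<notin> N"
    if c: "c \<in> carrier R" and t: "t \<in> residual R M N" and cm: "c \<odot>\<^bsub>M\<^esub> m \<notin> N" for c t
  proof
    assume "(c \<oplus> t) \<odot>\<^bsub>M\<^esub> (m \<oplus>\<^bsub>M\<^esub> n) \<in> N"
    moreover have "(c \<oplus> t) \<odot>\<^bsub>M\<^esub> (m \<oplus>\<^bsub>M\<^esub> n)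
        = c \<odot>\<^bsub>M\<^esub> m \<oplus>\<^bsub>M\<^esub> (c \<odot>\<^bsub>M\<^esub> n \<oplus>\<^bsub>M\<^esub> t \<odot>\<^bsub>M\<^esub> (m \<oplus>\<^bsub>M\<^esub> n))"
      using c residualD(1)[OF t] m nc by (simp add: smult_l_distr smult_r_distr M.a_ac)
    moreover have "c \<odot>\<^bsub>M\<^esub> n \<oplus>\<^bsub>M\<^esub> t \<odot>\<^bsub>M\<^esub> (m \<oplus>\<^bsub>M\<^esub> n) \<in> N"
      using c n m nc by (intro add smult residualD(2)[OF t]) auto
    ultimately show False
      using cm submodule_add_cancel[OF N smult_closed[OF c m]] by simp
  qed
  \<comment> \<open>The grouping leaves \<open>a b m\<close> and three terms visibly in
    \<open>N\<close>: a multiple of \<open>n\<close>, a multiple of an element of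
    \<open>s M\<close>, and an element of \<open>r M\<close>.\<close>
  have "((a \<oplus> r) \<otimes> (b \<oplus> s)) \<odot>\<^bsub>M\<^esub> (m \<oplus>\<^bsub>M\<^esub> n)
      = (a \<otimes> b) \<odot>\<^bsub>M\<^esub> m \<oplus>\<^bsub>M\<^esub> ((a \<otimes> b) \<odot>\<^bsub>M\<^esub> n \<oplus>\<^bsub>M\<^esub>
        (a \<odot>\<^bsub>M\<^esub> (s \<odot>\<^bsub>M\<^esub> (m \<oplus>\<^bsub>M\<^esub> n)) \<oplus>\<^bsub>M\<^esub> r \<odot>\<^bsub>M\<^esub> ((b \<oplus> s) \<odot>\<^bsub>M\<^esub> (m \<oplus>\<^bsub>M\<^esub> n))))"
  proof -
    let ?w = "m \<oplus>\<^bsub>M\<^esub> n"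
    have w: "?w \<in> carrier M"
      using m nc by simp
    have "((a \<oplus> r) \<otimes> (b \<oplus> s)) \<odot>\<^bsub>M\<^esub> ?w
        = a \<odot>\<^bsub>M\<^esub> ((b \<oplus> s) \<odot>\<^bsub>M\<^esub> ?w) \<oplus>\<^bsub>M\<^esub> r \<odot>\<^bsub>M\<^esub> ((b \<oplus> s) \<odot>\<^bsub>M\<^esub> ?w)"
      using a b rc sc w by (simp only: smult_assoc1 smult_l_distr R.add.m_closed M.add.m_closed smult_closed)
    moreover have "a \<odot>\<^bsub>M\<^esub> ((b \<oplus> s) \<odot>\<^bsub>M\<^esub> ?w) = (a \<otimes> b) \<odot>\<^bsub>M\<^esub> ?w \<oplus>\<^bsub>M\<^esub> a \<odot>\<^bsub>M\<^esub> (s \<odot>\<^bsub>M\<^esub> ?w)"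
      using a b sc w by (simp only: smult_assoc1 smult_l_distr smult_r_distr smult_closed)
    moreover have "(a \<otimes> b) \<odot>\<^bsub>M\<^esub> ?w = (a \<otimes> b) \<odot>\<^bsub>M\<^esub> m \<oplus>\<^bsub>M\<^esub> (a \<otimes> b) \<odot>\<^bsub>M\<^esub> n"
      using a b m nc by (intro smult_r_distr) auto
    ultimately show ?thesis
      using a b m nc rc sc w by (simp only: M.a_assoc smult_closed R.add.m_closed R.m_closed M.add.m_closed)
  qed
  also have "\<dots> \<in> N"
    using a b m nc rc sc n
    by (intro add abm smult residualD(2)[OF r] residualD(2)[OF s]) auto
  finally show False
    using wcp nz notin[OF a r am] notin[OF b s bm] a b m nc rc sc
    unfolding weakly_classical_prime_submodule_def by blast
qed

lemma residual_residual_smult_eq_zero: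
  assumes wcp: "weakly_classical_prime_submodule R M N"
    and ncp: "\<not> classical_prime_submodule R M N"
    and r: "r \<in> residual R M N" and s: "s \<in> residual R M N" and n: "n \<in> N"
  shows "(r \<otimes> s) \<odot>\<^bsub>M\<^esub> n = \<zero>\<^bsub>M\<^esub>"
proof -
  have N: "submodule N R M"
    using wcp by (simp add: weakly_classical_prime_submodule_def)
  \<comment> \<open>\<open>N\<close> is a proper submodule, so classical primeness can only fail in
    its multiplicative clause.\<close>
  obtain a b m where a: "a \<in> carrier R" and b: "b \<in> carrier R" and m: "m \<in> carrier M"
    and abm: "(a \<otimes> b) \<odot>\<^bsub>M\<^esub> m \<in> N"
    and am: "a \<odot>\<^bsub>M\<^esub> m \<notin> N" and bm: "b \<odot>\<^bsub>M\<^esub> m \<notin> N"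
    using wcp ncp
    unfolding weakly_classical_prime_submodule_def classical_prime_submodule_def by blast
  note perturb = weakly_classical_prime_perturbation[OF wcp a b m abm am bm]
  have nc: "n \<in> carrier M"
    using submoduleE(1)[OF N] n by blast
  have zero: "\<zero> \<in> residual R M N"
    using ideal_residual[OF N] by (simp add: additive_subgroup.zero_closed ideal.axioms(1))
  note rc = residualD(1)[OF r] and sc = residualD(1)[OF s]
  \<comment> \<open>Both \<open>t\<close> and \<open>u\<close> stay arbitrary because the later
    subtractions also instantiate them with zero, which lies in the residual.\<close>
  have 1: "((a \<oplus> t) \<otimes> (b \<oplus> u)) \<odot>\<^bsub>M\<^esub> n = \<zero>\<^bsub>M\<^esub>"
    if t: "t \<in> residual R M N" and u: "u \<in> residual R M N" for t u
    using perturb[OF t u n] perturb[OF t u submodule_zero_closed[OF N]]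
      a b m nc residualD(1)[OF t] residualD(1)[OF u]
    by (simp add: smult_r_distr)
  have 2: "((a \<oplus> t) \<otimes> s) \<odot>\<^bsub>M\<^esub> n = \<zero>\<^bsub>M\<^esub>" if t: "t \<in> residual R M N" for t
    using 1[OF t s] 1[OF t zero] a b nc residualD(1)[OF t] sc
    by (simp add: R.r_distr smult_l_distr)
  show ?thesis
    using 2[OF r] 2[OF zero] a nc rc sc
    by (simp add: R.l_distr smult_l_distr)
qed

end

theorem theorem2p19:
  fixes R :: "('r, 'k) ring_scheme" and M :: "('r, 'm, 'l) module_scheme" and N :: "'m set"
  assumes "module R M"
    and "\<one>\<^bsub>R\<^esub> \<noteq> \<zero>\<^bsub>R\<^esub>"
    and "weakly_classical_prime_submodule R M N"
    and "\<not> classical_prime_submodule R M N"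
  shows "ideal_submodule_prod R M (residual R M N [^]\<^bsub>ideals_set R\<^esub> (2::nat)) N = {\<zero>\<^bsub>M\<^esub>}
    \<and> nilpotent_submodule R M N"
proof -
  interpret module R M
    by fact
  let ?P = "residual R M N"
  have N: "submodule N R M"
    using assms(3) by (simp add: weakly_classical_prime_submodule_def)
  have P: "?P \<subseteq> carrier R"
    using residualD(1) by blast
  have "c \<odot>\<^bsub>M\<^esub> n = \<zero>\<^bsub>M\<^esub>" if c: "c \<in> ideal_prod R ?P ?P" and n: "n \<in> N" for c n
    by (rule ideal_prod_smult_eq_zero[OF P P subsetD[OF submoduleE(1)[OF N] n]
          residual_residual_smult_eq_zero[OF assms(3,4) _ _ n] c])
  then have square: "ideal_submodule_prod R M (?P [^]\<^bsub>ideals_set R\<^esub> (2::nat)) N = {\<zero>\<^bsub>M\<^esub>}"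
    unfolding ideal_submodule_prod_def ideals_set_pow_2[OF ideal_residual[OF N]]
    by (intro submodule_generated_eq_zero) auto
  \<comment> \<open>The exponent 2 witnesses nilpotency.\<close>
  then show ?thesis
    using N zero_less_numeral unfolding nilpotent_submodule_def by blast
qed

end
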